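(* There is a constant $c>0$ such that the following holds for every probability distribution $P=\{p_k;k\ge 1\}$ on a countable alphabet with effective cardinality $K=\sum_{k\ge 1}1[p_k>0]=\infty$: there exists a subsequence $\{n_k;k\ge 1\}$ in $\mathbb{N}$, satisfying $n_k\to\infty$ as $k\to\infty$, such that $t_{n_k}>c$ for all sufficiently large $k$, where $t_n=\sum_{i\ge 1}np_i(1-p_i)^n$.
   Context: A probability distribution on the countable alphabet $\mathscr{X}=\{\ell_k;k\ge 1\}$ is a sequence $P=\{p_k;k\ge 1\}$ with $p_k\ge 0$ and $\sum_{k\ge1}p_k=1$. The quantity $t_n$ ($n\ge 1$) is called the tail index of $P$. Here "subsequence in $\mathbb{N}$" means a sequence of positive integers $n_k$ tending to infinity (not required to be strictly increasing). *)

theory Defs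
  imports "HOL-Analysis.Infinite_Sum"
begin

text \<open>
  A distribution on the alphabet \<open>{l_k; k \<ge> 1}\<close> is identified with its sequence of probabilities.
  Sequences are indexed from 1: every sum below ranges over \<open>{1..}\<close>, so the value \<open>p 0\<close> is never
  used.
\<close>

definition prob_distribution :: "(nat \<Rightarrow> real) \<Rightarrow> bool" where
  "prob_distribution p \<longleftrightarrow> (\<forall>k\<ge>1. p k \<ge> 0) \<and> (p has_sum 1) {1..}"

text \<open>In \<^typ>\<open>enat\<close> every infinite sum converges, possibly to \<open>\<infinity>\<close>.\<close>

definition effective_cardinality :: "(nat \<Rightarrow> real) \<Rightarrow> enat" where
  "effective_cardinality p = (\<Sum>\<^sub>\<infinity>k\<in>{1..}. of_bool (p k > 0))"

definition tail_index :: "(nat \<Rightarrow> real) \<Rightarrow> nat \<Rightarrow> real" where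
  "tail_index p n = (\<Sum>\<^sub>\<infinity>i\<in>{1..}. real n * p i * (1 - p i) ^ n)"

text \<open>
  The series is not a sum over a non-summable family (where \<^const>\<open>infsum\<close> would be 0).
\<close>

lemma tail_index_summable:
  assumes "prob_distribution p"
  shows "(\<lambda>i. real n * p i * (1 - p i) ^ n) summable_on {1..}"
proof -
  have nonneg: "p i \<ge> 0" if "i \<in> {1..}" for i
    using assms that by (auto simp: prob_distribution_def)
  have sum: "(p has_sum 1) {1..}"
    using assms by (simp add: prob_distribution_def)
  have le1: "p i \<le> 1" if "i \<in> {1..}" for i
  proof -
    have "sum p {i} \<le> 1"
      using that nonneg by (intro has_sum_mono2[OF has_sum_finite sum]) auto
    then show ?thesis by simp
  qed
  have "(\<lambda>i. real n * p i) summable_on {1..}"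
    using sum by (intro summable_on_cmult_right) (auto simp: summable_on_def)
  then show ?thesis
  proof (rule summable_on_comparison_test)
    fix i :: nat assume i: "i \<in> {1..}"
    show "0 \<le> real n * p i * (1 - p i) ^ n"
      using nonneg[OF i] le1[OF i] by simp
    have "(1 - p i) ^ n \<le> 1"
      using nonneg[OF i] le1[OF i] by (intro power_le_one) auto
    then show "real n * p i * (1 - p i) ^ n \<le> real n * p i"
      using nonneg[OF i] by (intro mult_left_le) auto
  qed
qed

lemma effective_cardinality_eq_infinity_iff:
  "effective_cardinality p = \<infinity> \<longleftrightarrow> infinite {k. k \<ge> 1 \<and> p k > 0}"
proof -
  define S where "S = {k::nat. k \<ge> 1 \<and> p k > 0}"
  have eq: "effective_cardinality p = (\<Sum>\<^sub>\<infinity>k\<in>S. (1::enat))"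
    unfolding effective_cardinality_def S_def
    by (rule infsum_cong_neutral) auto
  show ?thesis
  proof (cases "finite S")
    case True
    then show ?thesis
      using eq by (simp add: S_def of_nat_eq_enat)
  next
    case False
    then have "(\<Sum>\<^sub>\<infinity>k\<in>S. (1::enat)) = \<infinity>"
      by (intro infsum_superconst_infinite_enat[where b = 1]) auto
    with eq False show ?thesis by (simp add: S_def)
  qed
qed

end

(* If 0 < p i \<le> 1/4 and n = floor (1 / (2 * p i)), then 1/4 < n * p i \<le> 1/2, and Bernoulli's
   inequality gives (1 - p i) ^ n \<ge> 1/2, so the single term i contributes more than 1/8 to
   t_n. Infinite support forces arbitrarily small positive p i, hence arbitrarily large such n. *)
theory Submission
  imports Defs
begin

lemma prob_distribution_sum_le_1:
  assumes "prob_distribution p" "finite F" "F \<subseteq> {1..}"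
  shows "sum p F \<le> 1"
  using assms
  by (intro has_sum_mono2[OF has_sum_finite, where B = "{1..}" and f = p])
     (auto simp: prob_distribution_def)

lemma prob_distribution_le_1:
  assumes "prob_distribution p" "i \<ge> 1"
  shows "p i \<le> 1"
  using prob_distribution_sum_le_1[OF assms(1), of "{i}"] assms(2) by simp

text \<open>If every positive mass were at least \<open>e\<close>, then any \<open>N\<close> >
  1/\<open>e\<close> of them, available because the support is infinite, would already have total
  mass above 1.\<close>

lemma small_positive_mass:
  assumes P: "prob_distribution p" and inf: "effective_cardinality p = \<infinity>" and e: "e > 0"
  obtains i where "i \<ge> 1" "0 < p i" "p i < e"
proof -
  define S where "S = {k. k \<ge> 1 \<and> p k > 0}"
  have "\<exists>i\<in>S. p i < e"
  proof (rule ccontr)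
    assume "\<not> (\<exists>i\<in>S. p i < e)"
    then have ge: "p i \<ge> e" if "i \<in> S" for i
      using that by force
    obtain N :: nat where N: "1 / e < real N"
      using reals_Archimedean2 by blast
    have "infinite S"
      using inf unfolding effective_cardinality_eq_infinity_iff S_def .
    then obtain F where F: "F \<subseteq> S" "finite F" "card F = N"
      using infinite_arbitrarily_large by blast
    have "1 < real N * e"
      using N e by (simp add: field_simps)
    also have "\<dots> = (\<Sum>i\<in>F. e)"
      using F by simp
    also have "\<dots> \<le> sum p F"
      using F ge by (intro sum_mono) auto
    also have "\<dots> \<le> 1"
      using F by (intro prob_distribution_sum_le_1[OF P]) (auto simp: S_def)
    finally show False by simp
  qed
  then show thesis
    using that by (auto simp: S_def)
qed

text \<open>Every term is nonnegative since \<open>p j\<close> lies in [0, 1], and the series is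
  summable, so a one-element partial sum bounds it from below.\<close>

lemma tail_index_ge_term:
  assumes P: "prob_distribution p" and i: "i \<ge> 1"
  shows "real n * p i * (1 - p i) ^ n \<le> tail_index p n"
proof -
  have "(\<Sum>j\<in>{i}. real n * p j * (1 - p j) ^ n) \<le> tail_index p n"
    unfolding tail_index_def
  proof (rule finite_sum_le_infsum[OF tail_index_summable[OF P]])
    fix j :: nat assume "j \<in> {1..} - {i}"
    then show "0 \<le> real n * p j * (1 - p j) ^ n"
      using P prob_distribution_le_1[OF P, of j] by (auto simp: prob_distribution_def)
  qed (use i in auto)
  then show ?thesis by simp
qed

lemma term_gt_eighth:
  fixes x :: real
  assumes x: "0 < x" "x \<le> 1 / 4" and n: "n = nat \<lfloor>1 / (2 * x)\<rfloor>"
  shows "1 / 8 < real n * x * (1 - x) ^ n"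
proof -
  \<comment> \<open>As \<open>x\<close> is positive the floor is nonnegative, so \<open>nat\<close>
    truncates nothing.\<close>
  have n': "real n = of_int \<lfloor>1 / (2 * x)\<rfloor>"
    using x n by simp
  have "real n \<le> 1 / (2 * x)" "1 / (2 * x) < real n + 1"
    unfolding n' by linarith+
  then have le: "real n * x \<le> 1 / 2" and "1 / 2 < real n * x + x"
    \<comment> \<open>Rounding down lowers \<open>n * x\<close> by less than \<open>x\<close> from
      1/2; the bound \<open>x\<close> \<le> 1/4 keeps it above 1/4.\<close>
    using x by (auto simp: field_simps)
  then have gt: "1 / 4 < real n * x"
    using x by linarith
  have "1 / 2 \<le> (1 - x) ^ n"
    using Bernoulli_inequality[of "- x" n] x le by simp
  then have "real n * x * (1 / 2) \<le> real n * x * (1 - x) ^ n"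
    using x by (intro mult_left_mono) auto
  then show ?thesis
    using gt by linarith
qed

lemma large_tail_index:
  assumes P: "prob_distribution p" and inf: "effective_cardinality p = \<infinity>"
  shows "\<exists>n. n \<ge> 1 \<and> n \<ge> N \<and> tail_index p n > 1 / 8"
proof -
  have "1 / (4 * (real N + 1)) > 0"
    by simp
  \<comment> \<open>The threshold serves two purposes: it is at most 1/4, as
    \<open>term_gt_eighth\<close> demands, and it forces 1/(2 \<open>p i\<close>) above
    2(\<open>N\<close> + 1), so that \<open>n\<close> is large.\<close>
  then obtain i where i: "i \<ge> 1" "0 < p i" and small: "p i < 1 / (4 * (real N + 1))"
    using small_positive_mass[OF P inf] by blast
  define n where "n = nat \<lfloor>1 / (2 * p i)\<rfloor>"
  have "1 / (4 * (real N + 1)) \<le> 1 / 4"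
    by (simp add: field_simps)
  with small have "p i \<le> 1 / 4"
    by linarith
  then have "1 / 8 < real n * p i * (1 - p i) ^ n"
    using i by (intro term_gt_eighth) (auto simp: n_def)
  also have "\<dots> \<le> tail_index p n"
    by (rule tail_index_ge_term[OF P i(1)])
  finally have "1 / 8 < tail_index p n" .
  moreover have "real (N + 1) \<le> 1 / (2 * p i)"
    using small i by (simp add: field_simps)
  \<comment> \<open>An integer lower bound survives the floor. Aiming at \<open>N + 1\<close>
    instead of \<open>N\<close> also gives \<open>n\<close> \<ge> 1 when \<open>N\<close> =
    0.\<close>
  then have "N + 1 \<le> n"
    unfolding n_def by linarith
  ultimately show ?thesis
    by (intro exI[of _ n]) auto
qed

theorem lemma1:
  shows "\<exists>c::real. c > 0 \<and>
    (\<forall>p :: nat \<Rightarrow> real.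
      prob_distribution p \<longrightarrow> effective_cardinality p = \<infinity> \<longrightarrow>
      (\<exists>m :: nat \<Rightarrow> nat.
        (\<forall>k\<ge>1. m k \<ge> 1) \<and>
        filterlim m at_top sequentially \<and>
        (\<forall>\<^sub>F k in sequentially. tail_index p (m k) > c)))"
proof (intro exI[of _ "1 / 8"] conjI allI impI)
  fix p :: "nat \<Rightarrow> real"
  assume "prob_distribution p" "effective_cardinality p = \<infinity>"
  then have "\<forall>N. \<exists>n. n \<ge> 1 \<and> n \<ge> N \<and> tail_index p n > 1 / 8"
    using large_tail_index by blast
  then obtain m where m: "\<And>N. m N \<ge> 1 \<and> m N \<ge> N \<and> tail_index p (m N) > 1 / 8"
    by metis
  \<comment> \<open>The chosen \<open>m\<close> dominates the identity, so it diverges even though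
    it may repeat values or fail to be monotone.\<close>
  have "filterlim m at_top sequentially"
    by (rule filterlim_at_top_mono[OF filterlim_ident]) (use m in auto)
  then show "\<exists>m. (\<forall>k\<ge>1. m k \<ge> 1) \<and> filterlim m at_top sequentially \<and>
      (\<forall>\<^sub>F k in sequentially. tail_index p (m k) > 1 / 8)"
    using m by (intro exI[of _ m]) auto
qed simp

end
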